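(* Let $K\subset\mathbb{R}^n$ be a nontrivial closed convex pointed cone, suppose $0\notin\operatorname{cl}\operatorname{aff}(E_K)$, and set $d:=-P_{\operatorname{cl}\operatorname{aff}(E_K)}(0)$. Then the admissible set $\mathcal{P}_K:=\{v\in\mathbb{R}^n:d+v\in K^\circ\}$ satisfies $$\mathcal{P}_K=\bigcap_{u\in E_K}\{v\in\mathbb{R}^n:\langle v,u\rangle\le\|d\|^2\}.$$ The closed Euclidean ball $\bar B(0,\|d\|^2)$ is the largest ball centered at the origin contained in $\mathcal{P}_K$: it is contained in $\mathcal{P}_K$, and for every $r>\|d\|^2$ and every $u\in E_K$, the point $ru$ belongs to $\bar B(0,r)\setminus\mathcal{P}_K$. Moreover, $$\partial\bar B(0,\|d\|^2)\cap\partial\mathcal{P}_K=\|d\|^2\,\operatorname{cl}E_K.$$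
   Context: $\langle\cdot,\cdot\rangle$ and $\|\cdot\|$ are the Euclidean inner product and norm on $\mathbb{R}^n$, $\bar B(0,r)=\{v:\|v\|\le r\}$, $\partial$ denotes topological boundary, $\operatorname{cl}$ closure, and $\lambda S=\{\lambda s:s\in S\}$. Nontrivial means $K\ne\{0\}$; pointed means $K\cap(-K)=\{0\}$. The extremal section of $K$ is $E_K:=\{u\in\mathbb{R}^n:\|u\|=1,\ \mathbb{R}_+u\text{ is an extreme ray of }K\}$. The polar cone is $K^\circ=\{w\in\mathbb{R}^n:\langle w,z\rangle\le0\ \text{for all }z\in K\}$. $\operatorname{aff}$ denotes affine hull and $P_A$ denotes orthogonal projection onto a nonempty closed affine set $A$. *)

theory Defs
  imports "HOL-Analysis.Analysis"
begin

definition ray :: "'a::real_vector \<Rightarrow> 'a set" where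
  "ray u = {t *\<^sub>R u | t. 0 \<le> t}"

definition pointed :: "'a::real_vector set \<Rightarrow> bool" where
  "pointed K \<longleftrightarrow> K \<inter> uminus ` K = {0}"

(* An extreme ray of K is a half-line from the origin that is a face of K. *)
definition extremal_section :: "'a::real_inner set \<Rightarrow> 'a set" where
  "extremal_section K = {u. norm u = 1 \<and> ray u face_of K}"

definition polar_cone :: "'a::real_inner set \<Rightarrow> 'a set" where
  "polar_cone K = {w. \<forall>z\<in>K. w \<bullet> z \<le> 0}"

definition admissible_set :: "'a::real_inner set \<Rightarrow> 'a \<Rightarrow> 'a set" where
  "admissible_set K d = {v. d + v \<in> polar_cone K}"

end

theory Submission
  imports Defs
begin

text \<open>
  Separating the origin from the convex hull of the unit vectors of \<open>K\<close> gives a linear functional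
  that is strictly positive on \<open>K - {0}\<close>, hence a compact base of \<open>K\<close>. The extreme points of the
  base span extreme rays, so by Krein--Milman a linear functional that is nonpositive on \<open>E\<^sub>K\<close> is
  nonpositive on \<open>K\<close>. Since \<open>d \<bullet> u = - \<parallel>d\<parallel>\<^sup>2\<close> for all \<open>u\<close> in the affine hull of \<open>E\<^sub>K\<close>, this turns
  \<open>d + v \<in> K\<degree>\<close> into \<open>v \<bullet> u \<le> \<parallel>d\<parallel>\<^sup>2\<close> for \<open>u \<in> E\<^sub>K\<close>. As \<open>E\<^sub>K\<close> consists of unit vectors, the claims on
  balls and boundaries are Cauchy--Schwarz together with its equality case.
\<close>

section \<open>Positive functionals on pointed cones\<close>

text \<open>A vanishing convex combination would make its two terms opposite elements of
  \<open>K\<close>, so pointedness kills both, although one of the weights is nonzero.\<close>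

lemma convex_pointed_cone_minus_zero:
  fixes K :: "'a::real_vector set"
  assumes "cone K" "convex K" "pointed K"
  shows "convex (K - {0})"
proof (rule convexI)
  fix x y :: 'a and s t :: real
  assume xy: "x \<in> K - {0}" "y \<in> K - {0}" and st: "0 \<le> s" "0 \<le> t" "s + t = 1"
  have "s *\<^sub>R x + t *\<^sub>R y \<noteq> 0"
  proof
    assume eq: "s *\<^sub>R x + t *\<^sub>R y = 0"
    have "s *\<^sub>R x \<in> K" "t *\<^sub>R y \<in> K"
      using xy st \<open>cone K\<close> by (auto simp: cone_def)
    moreover have "s *\<^sub>R x = - (t *\<^sub>R y)" "t *\<^sub>R y = - (s *\<^sub>R x)"
      using eq by (simp_all add: eq_neg_iff_add_eq_0 add.commute)
    ultimately have "s *\<^sub>R x \<in> K \<inter> uminus ` K" "t *\<^sub>R y \<in> K \<inter> uminus ` K"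
      by blast+
    then have "s *\<^sub>R x = 0" "t *\<^sub>R y = 0"
      using \<open>pointed K\<close> unfolding pointed_def by blast+
    then show False using xy st by auto
  qed
  moreover have "s *\<^sub>R x + t *\<^sub>R y \<in> K"
    using xy st \<open>convex K\<close> by (auto simp: convex_def)
  ultimately show "s *\<^sub>R x + t *\<^sub>R y \<in> K - {0}" by blast
qed

text \<open>The bound by a multiple of the norm, rather than mere positivity, is what later makes
  the slice \<open>a \<bullet> z = 1\<close> bounded. It comes from strict separation of
  \<open>0\<close> from a compact convex set.\<close>

lemma pointed_cone_positive_functional:
  fixes K :: "'a::euclidean_space set"
  assumes "cone K" "convex K" "closed K" "pointed K"
  obtains a b where "b > 0" "\<And>x. x \<in> K \<Longrightarrow> b * norm x \<le> a \<bullet> x"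
proof -
  let ?S = "K \<inter> sphere 0 1"
  have "compact ?S"
    using \<open>closed K\<close> by (simp add: closed_Int_compact)
  moreover have "convex hull ?S \<subseteq> K - {0}"
    by (rule hull_minimal) (auto intro: convex_pointed_cone_minus_zero assms)
  ultimately have "closed (convex hull ?S)" "0 \<notin> convex hull ?S"
    by (auto intro: compact_convex_hull compact_imp_closed)
  then obtain a b where b: "b > 0" and a: "\<And>x. x \<in> convex hull ?S \<Longrightarrow> b < a \<bullet> x"
    using separating_hyperplane_closed_0[OF convex_convex_hull] by metis
  have "b * norm x \<le> a \<bullet> x" if "x \<in> K" for x
  proof (cases "x = 0")
    case False
    have "inverse (norm x) *\<^sub>R x \<in> ?S"
      using that False \<open>cone K\<close> by (auto simp: cone_def)
    then have "b < a \<bullet> (inverse (norm x) *\<^sub>R x)"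
      by (intro a hull_inc)
    then show ?thesis using False by (simp add: field_simps)
  qed simp
  with b show ?thesis using that by blast
qed

section \<open>Extreme rays and the polar cone\<close>

lemma ray_scaleR:
  assumes "c > 0"
  shows "ray (c *\<^sub>R x) = ray x"
proof -
  have "\<exists>s. t *\<^sub>R x = s *\<^sub>R c *\<^sub>R x \<and> 0 \<le> s" if "t \<ge> 0" for t
    using that assms by (intro exI[of _ "t / c"]) auto
  moreover have "\<exists>s. t *\<^sub>R c *\<^sub>R x = s *\<^sub>R x \<and> 0 \<le> s" if "t \<ge> 0" for t
    using that assms by (intro exI[of _ "t * c"]) auto
  ultimately show ?thesis unfolding ray_def by blast
qed

text \<open>If a segment in \<open>K\<close> crosses the ray of \<open>x\<close> in its interior,
  rescaling its endpoints into the base exhibits \<open>x\<close> as a proper convex combination of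
  them. Extremality then makes the rescaled endpoints equal to \<open>x\<close>.\<close>

lemma ray_extreme_point_of_base:
  fixes K :: "'a::real_inner set"
  assumes "cone K" and pos: "\<And>x. x \<in> K \<Longrightarrow> x \<noteq> 0 \<Longrightarrow> 0 < a \<bullet> x"
    and ext: "x extreme_point_of {z \<in> K. a \<bullet> z = 1}"
  shows "ray x face_of K"
proof -
  let ?B = "{z \<in> K. a \<bullet> z = 1}"
  have x: "x \<in> K" "a \<bullet> x = 1"
    using ext by (auto simp: extreme_point_of_def)
  have base: "inverse (a \<bullet> z) *\<^sub>R z \<in> ?B" if "z \<in> K" "z \<noteq> 0" for z
    using that pos[OF that] \<open>cone K\<close> by (auto simp: cone_def)
  have "p \<in> ray x \<and> q \<in> ray x"
    if pq: "p \<in> K" "q \<in> K" and y: "y \<in> ray x" "y \<in> open_segment p q" for p q y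
  proof -
    obtain s where s: "0 < s" "s < 1" "y = (1 - s) *\<^sub>R p + s *\<^sub>R q"
      using y by (auto simp: in_segment)
    obtain t where t: "0 \<le> t" "y = t *\<^sub>R x"
      using y by (auto simp: ray_def)
    show ?thesis
    \<comment> \<open>An endpoint at the origin cannot be rescaled into the base; in that case the
      other endpoint is a positive multiple of \<open>y\<close>.\<close>
    proof (cases "p = 0 \<or> q = 0")
      case True
      have "0 \<in> ray x" by (force simp: ray_def)
      moreover have "p \<in> ray x" if "q = 0"
      proof -
        have "p = (1 / (1 - s)) *\<^sub>R y" using s that by simp
        then have "p = (t / (1 - s)) *\<^sub>R x" using t by simp
        then show ?thesis using s t unfolding ray_def by force
      qed
      moreover have "q \<in> ray x" if "p = 0"
      proof -
        have "q = (1 / s) *\<^sub>R y" using s that by simp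
        then have "q = (t / s) *\<^sub>R x" using t by simp
        then show ?thesis using s t unfolding ray_def by force
      qed
      ultimately show ?thesis using True by blast
    next
      case False
      define f g where "f = a \<bullet> p" and "g = a \<bullet> q"
      have fg: "f > 0" "g > 0"
        using pos pq False by (auto simp: f_def g_def)
      define P Q where "P = inverse f *\<^sub>R p" and "Q = inverse g *\<^sub>R q"
      have PQ: "P \<in> ?B" "Q \<in> ?B" "p = f *\<^sub>R P" "q = g *\<^sub>R Q"
        using base pq False fg by (auto simp: P_def Q_def f_def g_def)
      have "a \<bullet> y = (1 - s) * f + s * g"
        using s by (simp add: inner_simps f_def g_def)
      moreover have "a \<bullet> y = t" using t x by simp
      ultimately have teq: "t = (1 - s) * f + s * g" by simp
      have tpos: "t > 0" unfolding teq using s fg by (simp add: add_pos_pos)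
      \<comment> \<open>Applying \<open>a\<close> to \<open>y\<close> splits \<open>t\<close> into
        the contributions of \<open>p\<close> and \<open>q\<close>; \<open>r\<close> is the share of
        \<open>q\<close>, so \<open>r\<close> and \<open>1 - r\<close> are the weights of
        \<open>Q\<close> and \<open>P\<close> in \<open>x\<close>.\<close>
      define r where "r = s * g / t"
      have r: "0 < r" "r < 1" "1 - r = (1 - s) * f / t"
        using s fg tpos by (auto simp: r_def teq field_simps)
      have "x = (1 / t) *\<^sub>R y" using t tpos by simp
      also have "\<dots> = (1 - r) *\<^sub>R P + r *\<^sub>R Q"
        unfolding r(3) by (simp add: s(3) PQ r_def scaleR_add_right)
      finally have xeq: "x = (1 - r) *\<^sub>R P + r *\<^sub>R Q" .
      have "x \<notin> open_segment P Q"
        using ext PQ by (auto simp: extreme_point_of_def)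
      then have "P = Q" using xeq r unfolding in_segment by blast
      then have "x = P" using xeq by (simp flip: scaleR_add_left)
      then show ?thesis using PQ fg \<open>P = Q\<close> unfolding ray_def
        by (metis (mono_tags, lifting) less_imp_le mem_Collect_eq)
    qed
  qed
  moreover have "ray x \<subseteq> K"
    using x \<open>cone K\<close> by (auto simp: ray_def cone_def)
  moreover have "convex (ray x)"
  proof (rule convexI)
    fix y z :: 'a and u v :: real
    assume yz: "y \<in> ray x" "z \<in> ray x" and uv: "0 \<le> u" "0 \<le> v"
    obtain s t where "0 \<le> s" "0 \<le> t" "y = s *\<^sub>R x" "z = t *\<^sub>R x"
      using yz by (auto simp: ray_def)
    then have "u *\<^sub>R y + v *\<^sub>R z = (u * s + v * t) *\<^sub>R x" "0 \<le> u * s + v * t"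
      using uv by (auto simp: scaleR_add_left)
    then show "u *\<^sub>R y + v *\<^sub>R z \<in> ray x" unfolding ray_def by blast
  qed
  ultimately show ?thesis unfolding face_of_def by blast
qed

text \<open>Extreme points of the base need not be unit vectors, so the hull is taken over all
  positive multiples of elements of \<open>extremal_section K\<close>.\<close>

lemma pointed_cone_base:
  fixes K :: "'a::euclidean_space set"
  assumes "cone K" "convex K" "closed K" "pointed K"
  obtains a where "\<And>z. z \<in> K \<Longrightarrow> z \<noteq> 0 \<Longrightarrow> 0 < a \<bullet> z"
    "\<And>z. z \<in> K \<Longrightarrow> z \<noteq> 0 \<Longrightarrow> inverse (a \<bullet> z) *\<^sub>R z \<in>
       convex hull {x. inverse (norm x) *\<^sub>R x \<in> extremal_section K}"
proof -
  obtain a b where b: "b > 0" and a: "\<And>x. x \<in> K \<Longrightarrow> b * norm x \<le> a \<bullet> x"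
    using pointed_cone_positive_functional[OF assms] by blast
  have pos: "0 < a \<bullet> z" if "z \<in> K" "z \<noteq> 0" for z
    using a[OF that(1)] b that(2) by (smt (verit) mult_pos_pos zero_less_norm_iff)
  let ?B = "{z \<in> K. a \<bullet> z = 1}"
  have B: "?B = K \<inter> {z. a \<bullet> z = 1}" by blast
  have "norm z \<le> 1 / b" if "z \<in> ?B" for z
    using a[of z] that b by (simp add: field_simps)
  then have "bounded ?B" by (auto simp: bounded_iff)
  moreover have "closed ?B" unfolding B
    using \<open>closed K\<close> by (intro closed_Int closed_hyperplane)
  ultimately have "compact ?B" by (simp add: compact_eq_bounded_closed)
  moreover have "convex ?B" unfolding B
    using \<open>convex K\<close> by (intro convex_Int convex_hyperplane)
  ultimately have KM: "?B = convex hull {x. x extreme_point_of ?B}"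
    by (rule Krein_Milman_Minkowski)
  have "inverse (norm x) *\<^sub>R x \<in> extremal_section K" if "x extreme_point_of ?B" for x
  proof -
    have "x \<noteq> 0" using that by (auto simp: extreme_point_of_def)
    moreover have "ray x face_of K"
      using ray_extreme_point_of_base[OF \<open>cone K\<close> pos that] .
    ultimately show ?thesis
      by (simp add: extremal_section_def ray_scaleR)
  qed
  then have sub: "?B \<subseteq> convex hull {x. inverse (norm x) *\<^sub>R x \<in> extremal_section K}"
    by (subst KM) (intro hull_mono, blast)
  have "inverse (a \<bullet> z) *\<^sub>R z \<in> ?B" if "z \<in> K" "z \<noteq> 0" for z
    using pos[OF that] that \<open>cone K\<close> by (auto simp: cone_def)
  then show ?thesis using sub by (intro that[of a] pos) blast+
qed

lemma extremal_section_nonempty: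
  fixes K :: "'a::euclidean_space set"
  assumes "cone K" "convex K" "closed K" "pointed K" "K \<noteq> {0}"
  shows "extremal_section K \<noteq> {}"
proof
  assume empty: "extremal_section K = {}"
  have "0 \<in> K" using \<open>pointed K\<close> by (auto simp: pointed_def)
  then obtain z where "z \<in> K" "z \<noteq> 0" using \<open>K \<noteq> {0}\<close> by blast
  moreover have "{x. inverse (norm x) *\<^sub>R x \<in> extremal_section K} = {}"
    using empty by blast
  ultimately show False
    using pointed_cone_base[OF assms(1-4)] by (metis convex_hull_empty empty_iff)
qed

lemma extremal_section_subset:
  "extremal_section K \<subseteq> K"
proof
  fix u assume "u \<in> extremal_section K"
  then have "ray u \<subseteq> K" by (auto simp: extremal_section_def face_of_def)
  moreover have "u = 1 *\<^sub>R u" by simp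
  then have "u \<in> ray u" unfolding ray_def using zero_le_one by blast
  ultimately show "u \<in> K" by blast
qed

text \<open>Every nonzero point of \<open>K\<close> is a positive multiple of a point in the hull of
  the extreme directions, and a closed halfspace through the origin containing these directions
  contains their hull.\<close>

lemma polar_cone_iff_extremal_section:
  fixes K :: "'a::euclidean_space set"
  assumes "cone K" "convex K" "closed K" "pointed K"
  shows "w \<in> polar_cone K \<longleftrightarrow> (\<forall>u\<in>extremal_section K. w \<bullet> u \<le> 0)"
proof
  assume "w \<in> polar_cone K"
  then show "\<forall>u\<in>extremal_section K. w \<bullet> u \<le> 0"
    using extremal_section_subset by (auto simp: polar_cone_def)
next
  assume w: "\<forall>u\<in>extremal_section K. w \<bullet> u \<le> 0"
  obtain a where pos: "\<And>z. z \<in> K \<Longrightarrow> z \<noteq> 0 \<Longrightarrow> 0 < a \<bullet> z"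
    and hull: "\<And>z. z \<in> K \<Longrightarrow> z \<noteq> 0 \<Longrightarrow> inverse (a \<bullet> z) *\<^sub>R z \<in>
       convex hull {x. inverse (norm x) *\<^sub>R x \<in> extremal_section K}"
    using pointed_cone_base[OF assms] by blast
  have "w \<bullet> x \<le> 0" if "inverse (norm x) *\<^sub>R x \<in> extremal_section K" for x
  proof -
    \<comment> \<open>Since \<open>inverse 0 = 0\<close>, the choice \<open>x = 0\<close> would
      yield the zero vector, which has norm different from 1.\<close>
    have "x \<noteq> 0" using that by (auto simp: extremal_section_def)
    then show ?thesis using bspec[OF w that] by (simp add: field_simps)
  qed
  then have "convex hull {x. inverse (norm x) *\<^sub>R x \<in> extremal_section K} \<subseteq> {x. w \<bullet> x \<le> 0}"
    by (intro hull_minimal) (auto simp: convex_halfspace_le)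
  then have "w \<bullet> z \<le> 0" if "z \<in> K" for z
  proof (cases "z = 0")
    case False
    then have "w \<bullet> (inverse (a \<bullet> z) *\<^sub>R z) \<le> 0"
      using hull[OF that] \<open>convex hull _ \<subseteq> _\<close> by blast
    then show ?thesis using pos[OF that False] by (simp add: mult_le_0_iff)
  qed simp
  then show "w \<in> polar_cone K"
    by (simp add: polar_cone_def)
qed

section \<open>Affine projection and contact with the sphere\<close>

text \<open>For a convex set the obtuse-angle condition is one-sided; in an affine set it holds in
  both directions, hence with equality. This makes \<open>d \<bullet> u\<close> constant on the
  extremal section.\<close>

lemma inner_closest_point_affine:
  fixes A :: "'a::euclidean_space set"
  assumes "affine A" "u \<in> A"
  shows "closest_point A 0 \<bullet> u = (norm (closest_point A 0))\<^sup>2"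
proof -
  let ?p = "closest_point A 0"
  have A: "closed A" "convex A"
    using assms by (auto simp: affine_closed affine_imp_convex)
  have p: "?p \<in> A" using A assms by (intro closest_point_in_set) auto
  have obtuse: "(0 - ?p) \<bullet> (y - ?p) \<le> 0" if "y \<in> A" for y
    using closest_point_dot[OF A(2,1) that] .
  \<comment> \<open>the reflection of \<open>u\<close> at the closest point also lies in \<open>A\<close>\<close>
  have "2 *\<^sub>R ?p + (-1) *\<^sub>R u \<in> A"
    using \<open>affine A\<close> p \<open>u \<in> A\<close> by (intro mem_affine) auto
  from obtuse[OF this] obtuse[OF \<open>u \<in> A\<close>] show ?thesis
    by (simp add: inner_diff_left inner_diff_right inner_commute power2_norm_eq_inner)
qed

lemma norm_closure_extremal_section:
  fixes K :: "'a::euclidean_space set"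
  assumes "u \<in> closure (extremal_section K)"
  shows "norm u = 1"
proof -
  have "closure (extremal_section K) \<subseteq> sphere 0 1"
    by (intro closure_minimal) (auto simp: extremal_section_def)
  with assms show ?thesis by auto
qed

lemma inner_le_closure:
  fixes E :: "'a::real_inner set"
  assumes "\<forall>u\<in>E. v \<bullet> u \<le> c" "u \<in> closure E"
  shows "v \<bullet> u \<le> c"
proof -
  have "closure E \<subseteq> {z. v \<bullet> z \<le> c}"
    using assms(1) by (intro closure_minimal closed_halfspace_le) auto
  then show ?thesis using assms(2) by auto
qed

text \<open>A point of the sphere is a contact point exactly when some constraint from
  \<open>closure E\<close> is tight there, and tightness is equality in Cauchy--Schwarz. The closure
  appears because the supremum over \<open>E\<close> may not be attained in
  \<open>E\<close>.\<close>

lemma frontier_Inter_halfspaces_sphere: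
  fixes E :: "'a::euclidean_space set"
  assumes "E \<noteq> {}" and unit: "\<And>u. u \<in> closure E \<Longrightarrow> norm u = 1" and "\<rho> > 0"
  shows "sphere 0 \<rho> \<inter> frontier (\<Inter>u\<in>E. {v. v \<bullet> u \<le> \<rho>}) = (\<lambda>u. \<rho> *\<^sub>R u) ` closure E"
    (is "_ \<inter> frontier ?P = _")
proof -
  have "compact (closure E)"
    using unit by (auto simp: compact_eq_bounded_closed bounded_iff)
  have "closed ?P"
    by (intro closed_INT ballI closed_Collect_le continuous_intros)
  have "v \<in> (\<lambda>u. \<rho> *\<^sub>R u) ` closure E" if v: "norm v = \<rho>" "v \<in> frontier ?P" for v
  proof -
    have "continuous_on (closure E) (\<lambda>u. v \<bullet> u)"
      by (intro continuous_intros)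
    then obtain u where u: "u \<in> closure E" and max: "\<And>y. y \<in> closure E \<Longrightarrow> v \<bullet> y \<le> v \<bullet> u"
      using continuous_attains_sup[OF \<open>compact (closure E)\<close>] \<open>E \<noteq> {}\<close>
      by (metis closure_eq_empty)
    have "v \<bullet> u \<ge> \<rho>"
    proof (rule ccontr)
      assume less: "\<not> v \<bullet> u \<ge> \<rho>"
      \<comment> \<open>The gap below \<open>\<rho>\<close> at the maximiser \<open>u\<close> is a
        slack common to all constraints; as their normals are unit vectors, moving \<open>v\<close>
        by less than this gap violates none.\<close>
      have "ball v (\<rho> - v \<bullet> u) \<subseteq> ?P"
      proof (intro subsetI INT_I CollectI)
        fix x y assume x: "x \<in> ball v (\<rho> - v \<bullet> u)" and "y \<in> E"
        then have y: "y \<in> closure E" using closure_subset by blast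
        have "(x - v) \<bullet> y \<le> norm (x - v)"
          using norm_cauchy_schwarz[of "x - v" y] unit[OF y] by simp
        moreover have "norm (x - v) < \<rho> - v \<bullet> u"
          using x by (simp add: dist_norm norm_minus_commute)
        ultimately show "x \<bullet> y \<le> \<rho>" using max[OF y] by (simp add: inner_diff_left)
      qed
      then have "v \<in> interior ?P" using less
        by (intro interiorI[of "ball v (\<rho> - v \<bullet> u)"]) auto
      with v show False by (simp add: frontier_def)
    qed
    then have "v \<bullet> u = norm v * norm u"
      using norm_cauchy_schwarz[of v u] unit[OF u] v by simp
    then have "v = \<rho> *\<^sub>R u"
      unfolding norm_cauchy_schwarz_eq using unit[OF u] v by simp
    then show ?thesis using u by blast
  qed
  moreover have "\<rho> *\<^sub>R u \<in> sphere 0 \<rho> \<inter> frontier ?P" if u: "u \<in> closure E" for u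
  proof -
    have "u \<bullet> y \<le> 1" if "y \<in> E" for y
      using norm_cauchy_schwarz[of u y] unit[OF u] unit[of y] that closure_subset[of E] by auto
    then have "\<rho> *\<^sub>R u \<in> ?P" using \<open>\<rho> > 0\<close> by auto
    \<comment> \<open>Moving outward along \<open>u\<close> breaks the constraint with normal
      \<open>u\<close>, which points of \<open>?P\<close> satisfy by continuity even when
      \<open>u\<close> is only a limit of elements of \<open>E\<close>.\<close>
    moreover have "\<rho> *\<^sub>R u \<notin> interior ?P"
    proof
      assume "\<rho> *\<^sub>R u \<in> interior ?P"
      then obtain e where e: "e > 0" "cball (\<rho> *\<^sub>R u) e \<subseteq> ?P"
        by (meson mem_interior_cball)
      have "(\<rho> + e) *\<^sub>R u \<in> cball (\<rho> *\<^sub>R u) e"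
        using e unit[OF u] by (simp add: dist_norm scaleR_add_left)
      with e have "\<forall>y\<in>E. ((\<rho> + e) *\<^sub>R u) \<bullet> y \<le> \<rho>" by blast
      from inner_le_closure[OF this u] have "(\<rho> + e) * (u \<bullet> u) \<le> \<rho>" by simp
      then show False using e unit[OF u] by (simp add: dot_square_norm)
    qed
    ultimately show ?thesis
      using \<open>closed ?P\<close> unit[OF u] \<open>\<rho> > 0\<close> by (simp add: frontier_def)
  qed
  ultimately show ?thesis by auto
qed

theorem theorem6p4:
  fixes K :: "(real ^ 'n) set" and d :: "real ^ 'n"
  assumes "cone K" and "convex K" and "closed K" and "pointed K" and "K \<noteq> {0}"
    and "0 \<notin> closure (affine hull (extremal_section K))"
    and "d = - closest_point (closure (affine hull (extremal_section K))) 0"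
  shows "(admissible_set K d = (\<Inter>u\<in>extremal_section K. {v. v \<bullet> u \<le> (norm d)\<^sup>2}))
     \<and> (cball 0 ((norm d)\<^sup>2) \<subseteq> admissible_set K d)
     \<and> (\<forall>r. cball 0 r \<subseteq> admissible_set K d \<longrightarrow> r \<le> (norm d)\<^sup>2)
     \<and> (\<forall>r > (norm d)\<^sup>2. \<forall>u\<in>extremal_section K. r *\<^sub>R u \<in> cball 0 r - admissible_set K d)
     \<and> (frontier (cball 0 ((norm d)\<^sup>2)) \<inter> frontier (admissible_set K d)
           = (\<lambda>u. (norm d)\<^sup>2 *\<^sub>R u) ` closure (extremal_section K))"
proof -
  let ?E = "extremal_section K"
  \<comment> \<open>Affine subspaces are closed in finite dimension.\<close>
  have A: "closure (affine hull ?E) = affine hull ?E"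
    by simp
  have d: "d = - closest_point (affine hull ?E) 0"
    using assms(7) by (simp only: A)
  have nonempty: "?E \<noteq> {}"
    using extremal_section_nonempty assms by blast
  have "closest_point (affine hull ?E) 0 \<in> affine hull ?E"
    using nonempty by (intro closest_point_in_set) (auto simp: affine_closed)
  with assms(6) have "d \<noteq> 0" unfolding d A by auto
  then have pos: "(norm d)\<^sup>2 > 0" by simp
  have du: "d \<bullet> u = - (norm d)\<^sup>2" if "u \<in> ?E" for u
    using inner_closest_point_affine[of "affine hull ?E" u] that
    by (simp add: d hull_inc)
  have unit: "norm u = 1" if "u \<in> ?E" for u
    using that by (simp add: extremal_section_def)
  have eq: "admissible_set K d = (\<Inter>u\<in>?E. {v. v \<bullet> u \<le> (norm d)\<^sup>2})"
    using du by (auto simp: admissible_set_def inner_add_left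
        polar_cone_iff_extremal_section[OF assms(1-4)])
  have ball: "cball 0 ((norm d)\<^sup>2) \<subseteq> admissible_set K d"
  proof -
    have "v \<bullet> u \<le> (norm d)\<^sup>2" if "norm v \<le> (norm d)\<^sup>2" "u \<in> ?E" for u v
      using norm_cauchy_schwarz[of v u] unit[OF that(2)] that(1) by simp
    then show ?thesis by (auto simp: eq)
  qed
  have outside: "r *\<^sub>R u \<in> cball 0 r - admissible_set K d" if "r > (norm d)\<^sup>2" "u \<in> ?E" for r u
  proof -
    \<comment> \<open>The point \<open>r *\<^sub>R u\<close> violates the constraint given by
      \<open>u\<close> itself.\<close>
    have "r *\<^sub>R u \<bullet> u = r" using unit[OF that(2)] by (simp add: dot_square_norm)
    then have "r *\<^sub>R u \<notin> admissible_set K d" using that unfolding eq by force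
    moreover have "r \<ge> 0" using that(1) pos by linarith
    ultimately show ?thesis using unit[OF that(2)] by simp
  qed
  have "r \<le> (norm d)\<^sup>2" if "cball 0 r \<subseteq> admissible_set K d" for r
    using outside[of r] nonempty that by (meson DiffE ex_in_conv not_le subsetD)
  moreover have "frontier (cball 0 ((norm d)\<^sup>2)) \<inter> frontier (admissible_set K d)
      = (\<lambda>u. (norm d)\<^sup>2 *\<^sub>R u) ` closure ?E"
    using frontier_Inter_halfspaces_sphere[OF nonempty norm_closure_extremal_section pos] pos
    unfolding eq by simp
  ultimately show ?thesis using eq ball outside by blast
qed

end
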